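(* Let $G$ be a graph containing a cycle. Then the connected order of any bramble of $G$ is at most $\mathrm{tw}(G)\left\lfloor \frac{\ell(G)}{2}\right\rfloor+1$.
   Context: Graphs are finite, simple and undirected. $\mathrm{tw}(G)$ is the usual tree-width of $G$ (minimum over all tree-decompositions of the maximum part size minus one). A vertex set $X\subseteq V(G)$ is connected if $G[X]$ is connected; connected sets are non-empty. A bramble of $G$ is a collection of connected vertex sets of $G$ such that the union of any two of them is again connected. A cover of a bramble is a set of vertices that meets every element of the bramble. The connected order of a bramble is the minimum size of a connected cover of it. $\ell(G)$ denotes the smallest natural number $\ell$ such that the cycles of $G$ of length at most $\ell$ generate the cycle space of $G$ (over $\mathbb{F}_2$). *)

theory Defs
  imports Complex_Main "HOL-Library.Z2" "HOL-Library.Function_Algebras"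
    "HOL-Library.Indicator_Function"
begin

definition simple_graph :: "'a set \<Rightarrow> 'a set set \<Rightarrow> bool" where
  "simple_graph V E \<longleftrightarrow> finite V \<and> (\<forall>e\<in>E. e \<subseteq> V \<and> card e = 2)"

definition connected_graph :: "'a set \<Rightarrow> 'a set set \<Rightarrow> bool" where
  "connected_graph V E \<longleftrightarrow> V \<noteq> {} \<and> (\<forall>u\<in>V. \<forall>v\<in>V. (u, v) \<in> {(x, y). {x, y} \<in> E}\<^sup>*)"

definition induced_edges :: "'a set set \<Rightarrow> 'a set \<Rightarrow> 'a set set" where
  "induced_edges E X = {e \<in> E. e \<subseteq> X}"

definition connected_set :: "'a set \<Rightarrow> 'a set set \<Rightarrow> 'a set \<Rightarrow> bool" where
  "connected_set V E X \<longleftrightarrow> X \<subseteq> V \<and> connected_graph X (induced_edges E X)"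

(* A cycle is given by the cyclic sequence of its vertices; its length is the length of
   the list. *)

definition cycle_edges :: "'a list \<Rightarrow> 'a set set" where
  "cycle_edges xs = {{xs ! i, xs ! (Suc i mod length xs)} | i. i < length xs}"

definition is_cycle :: "'a set \<Rightarrow> 'a set set \<Rightarrow> 'a list \<Rightarrow> bool" where
  "is_cycle V E xs \<longleftrightarrow>
     3 \<le> length xs \<and> distinct xs \<and> set xs \<subseteq> V \<and> cycle_edges xs \<subseteq> E"

definition is_tree :: "'a set \<Rightarrow> 'a set set \<Rightarrow> bool" where
  "is_tree V E \<longleftrightarrow> simple_graph V E \<and> connected_graph V E \<and> (\<nexists>xs. is_cycle V E xs)"

definition tree_decomposition ::
  "'a set \<Rightarrow> 'a set set \<Rightarrow> 't set \<Rightarrow> 't set set \<Rightarrow> ('t \<Rightarrow> 'a set) \<Rightarrow> bool" where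
  "tree_decomposition V E N F P \<longleftrightarrow>
     is_tree N F \<and>
     (\<Union>t\<in>N. P t) = V \<and>
     (\<forall>e\<in>E. \<exists>t\<in>N. e \<subseteq> P t) \<and>
     (\<forall>v\<in>V. connected_set N F {t \<in> N. v \<in> P t})"

(* Truncated subtraction only matters for the graph without vertices. *)
definition width :: "'t set \<Rightarrow> ('t \<Rightarrow> 'a set) \<Rightarrow> nat" where
  "width N P = Max ((\<lambda>t. card (P t)) ` N) - 1"

(* Every finite tree is isomorphic to one whose nodes are natural numbers, so fixing the
   node type to nat loses no tree-decomposition. *)
definition treewidth :: "'a set \<Rightarrow> 'a set set \<Rightarrow> nat" where
  "treewidth V E =
     (LEAST w. \<exists>(N :: nat set) F P. tree_decomposition V E N F P \<and> width N P = w)"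

definition bramble :: "'a set \<Rightarrow> 'a set set \<Rightarrow> 'a set set \<Rightarrow> bool" where
  "bramble V E B \<longleftrightarrow>
     (\<forall>X\<in>B. connected_set V E X) \<and> (\<forall>X\<in>B. \<forall>Y\<in>B. connected_set V E (X \<union> Y))"

definition bramble_cover :: "'a set \<Rightarrow> 'a set set \<Rightarrow> 'a set \<Rightarrow> bool" where
  "bramble_cover V B C \<longleftrightarrow> C \<subseteq> V \<and> (\<forall>X\<in>B. C \<inter> X \<noteq> {})"

(* A bramble has a connected cover as soon as V is non-empty: a component containing all elements
   of B (any component, if B is empty). *)
definition connected_order :: "'a set \<Rightarrow> 'a set set \<Rightarrow> 'a set set \<Rightarrow> nat" where
  "connected_order V E B =
     (LEAST k. \<exists>C. bramble_cover V B C \<and> connected_set V E C \<and> card C = k)"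

(* Edge sets are vectors over the two-element field via their indicator functions. *)
definition edge_scale :: "bit \<Rightarrow> ('a set \<Rightarrow> bit) \<Rightarrow> 'a set \<Rightarrow> bit" where
  "edge_scale c f = (\<lambda>e. c * f e)"

global_interpretation edge_space: vector_space edge_scale
  by unfold_locales (auto simp: edge_scale_def fun_eq_iff algebra_simps)

definition cycle_vector :: "'a list \<Rightarrow> 'a set \<Rightarrow> bit" where
  "cycle_vector xs = indicator (cycle_edges xs)"

definition cycle_space :: "'a set \<Rightarrow> 'a set set \<Rightarrow> ('a set \<Rightarrow> bit) set" where
  "cycle_space V E = edge_space.span {cycle_vector xs | xs. is_cycle V E xs}"

definition cycle_gen_length :: "'a set \<Rightarrow> 'a set set \<Rightarrow> nat" where
  "cycle_gen_length V E =
     (LEAST l. edge_space.span {cycle_vector xs | xs. is_cycle V E xs \<and> length xs \<le> l}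
                 = cycle_space V E)"

end

theory Submission imports Defs begin

text \<open>
  Write \<open>w\<close> for the tree-width, \<open>l\<close> for the length such that the cycles of length at most \<open>l\<close>
  generate the cycle space, and \<open>k = l div 2\<close>. Call two vertices near if they lie in a common
  connected set of at most \<open>k + 1\<close> vertices, that is, if their distance is at most \<open>k\<close>. Suppose
  that no connected set of at most \<open>w * k + 1\<close> vertices covers the bramble.

  A set \<open>X\<close> of at most \<open>w + 1\<close> vertices falls into clusters, the classes of the equivalence
  relation generated by nearness inside \<open>X\<close>. Adding the vertices of a cluster one by one, each
  at the cost of at most \<open>k\<close> new vertices, gives a connected set of at most \<open>w * k + 1\<close> vertices
  that contains the cluster (\<open>cluster_connected_hull\<close>). So every single cluster \<open>Y\<close> misses an
  element of the bramble, and one component of \<open>G - Y\<close>, its side, contains all elements that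
  avoid \<open>Y\<close>. The set \<open>X\<close> itself may well be a cover. Nevertheless the intersection of the sides
  of its clusters is non-empty (\<open>haven_nonempty\<close>) and connected in \<open>G - X\<close> (\<open>haven_joined\<close>).

  Connectedness is the place where the cycle space enters, through a discrete form of
  Janiszewski's theorem (\<open>joined_avoiding_Un_if_far\<close>): if no generating cycle meets both \<open>A\<close>
  and \<open>B\<close>, then two vertices that neither \<open>A\<close> nor \<open>B\<close> separates are not separated by
  \<open>A \<union> B\<close>. It applies because two vertices on a cycle of length at most \<open>l\<close> are near, so that
  no such cycle meets two clusters of \<open>X\<close>.

  The intersections shrink when \<open>X\<close> grows, hence they form a haven: an escape strategy against
  \<open>w + 1\<close> searchers. A haven rules out tree-decompositions into parts of size at most \<open>w + 1\<close>
  (\<open>haven_contradicts_tree_decomposition\<close>), a contradiction to the choice of \<open>w\<close>.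
\<close>

section \<open>Joining vertices inside a vertex set\<close>

definition joined :: "'a set set \<Rightarrow> 'a set \<Rightarrow> 'a \<Rightarrow> 'a \<Rightarrow> bool" where
  "joined E S u v \<longleftrightarrow> u \<in> S \<and> v \<in> S \<and> (u, v) \<in> {(x, y). {x, y} \<in> induced_edges E S}\<^sup>*"

lemma joined_in: "joined E S u v \<Longrightarrow> u \<in> S" "joined E S u v \<Longrightarrow> v \<in> S"
  by (auto simp: joined_def)

lemma joined_refl: "u \<in> S \<Longrightarrow> joined E S u u"
  by (auto simp: joined_def)

lemma joined_trans: "joined E S u v \<Longrightarrow> joined E S v w \<Longrightarrow> joined E S u w"
  by (auto simp: joined_def)

lemma joined_sym: "joined E S u v \<Longrightarrow> joined E S v u"
proof -
  have "sym {(x, y). {x, y} \<in> induced_edges E S}"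
    by (auto simp: sym_def insert_commute)
  then show "joined E S u v \<Longrightarrow> joined E S v u"
    unfolding joined_def by (meson sym_rtrancl symD)
qed

lemma joined_edge: "{x, y} \<in> E \<Longrightarrow> x \<in> S \<Longrightarrow> y \<in> S \<Longrightarrow> joined E S x y"
  by (auto simp: joined_def induced_edges_def)

lemma joined_induct [consumes 1, case_names refl step]:
  assumes "joined E S u v"
    and "P u"
    and "\<And>x y. joined E S u x \<Longrightarrow> P x \<Longrightarrow> {x, y} \<in> E \<Longrightarrow> x \<in> S \<Longrightarrow> y \<in> S \<Longrightarrow> P y"
  shows "P v"
proof -
  have u: "u \<in> S" using assms(1) by (simp add: joined_def)
  have "(u, v) \<in> {(x, y). {x, y} \<in> induced_edges E S}\<^sup>*"
    using assms(1) by (simp add: joined_def)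
  then have "joined E S u v \<and> P v"
  proof (induction rule: rtrancl_induct)
    case base
    then show ?case using assms(2) u by (simp add: joined_refl)
  next
    case (step y z)
    then have e: "{y, z} \<in> E" "y \<in> S" "z \<in> S" by (auto simp: induced_edges_def)
    have "joined E S u z"
      by (rule joined_trans[OF _ joined_edge[OF e]]) (use step.IH in blast)
    moreover have "P z"
      by (rule assms(3)[OF _ _ e]) (use step.IH in blast)+
    ultimately show ?case by blast
  qed
  then show ?thesis by simp
qed

lemma joined_mono:
  assumes "joined E S u v" "S \<subseteq> T" "E \<subseteq> E'"
  shows "joined E' T u v"
  using assms(1)
proof (induction rule: joined_induct)
  case refl
  then show ?case using assms joined_in joined_refl by (metis subsetD)
next
  case (step x y)
  have "joined E' T x y"
    by (rule joined_edge) (use step.hyps assms(2,3) in blast)+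
  then show ?case by (rule joined_trans[OF step.IH])
qed

lemma joined_path:
  assumes "joined E S u v"
  shows "\<exists>xs. xs \<noteq> [] \<and> hd xs = u \<and> last xs = v \<and> set xs \<subseteq> S \<and> distinct xs
           \<and> successively (\<lambda>x y. {x, y} \<in> E) xs"
  using assms
proof (induction rule: joined_induct)
  case refl
  then show ?case using joined_in(1)[OF assms] by (intro exI[of _ "[u]"]) auto
next
  case (step x y)
  then obtain xs where xs: "xs \<noteq> []" "hd xs = u" "last xs = x" "set xs \<subseteq> S" "distinct xs"
    "successively (\<lambda>x y. {x, y} \<in> E) xs" by blast
  show ?case
  proof (cases "y \<in> set xs")
    case True
    then obtain as bs where s: "xs = as @ y # bs" by (meson split_list)
    have "successively (\<lambda>x y. {x, y} \<in> E) ((as @ [y]) @ bs)" using xs(6) s by simp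
    then have "successively (\<lambda>x y. {x, y} \<in> E) (as @ [y])"
      by (simp only: successively_append_iff)
    moreover have "hd (as @ [y]) = u" using xs(2) s by (cases as) auto
    ultimately show ?thesis
      using xs(4,5) s by (intro exI[of _ "as @ [y]"]) auto
  next
    case False
    show ?thesis
      using xs False step
      by (intro exI[of _ "xs @ [y]"]) (auto simp: successively_append_iff)
  qed
qed

lemma connected_set_iff_joined:
  "connected_set V E X \<longleftrightarrow> X \<subseteq> V \<and> X \<noteq> {} \<and> (\<forall>u\<in>X. \<forall>v\<in>X. joined E X u v)"
  by (auto simp: connected_set_def connected_graph_def joined_def)

lemma connected_set_Un:
  assumes X: "connected_set V E X" and Y: "connected_set V E Y" and "z \<in> X" "z \<in> Y"
  shows "connected_set V E (X \<union> Y)"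
proof -
  have "joined E (X \<union> Y) u z" if "u \<in> X \<union> Y" for u
    using that assms joined_mono[of E X u z "X \<union> Y" E] joined_mono[of E Y u z "X \<union> Y" E]
    by (auto simp: connected_set_iff_joined)
  then show ?thesis
    using X Y joined_trans joined_sym unfolding connected_set_iff_joined
    by (metis Un_empty le_sup_iff)
qed

section \<open>Sums along walks and the cycle space\<close>

lemma bit_add_self [simp]: "(a :: bit) + a = 0"
  by (cases a) auto

(* The default rules turn sums over the two-element field into equivalences of propositions,
   which hides them from the ring laws. *)
declare add_bit_eq_xor [simp del] mult_bit_eq_and [simp del]

fun walk_sum :: "('a set \<Rightarrow> bit) \<Rightarrow> 'a list \<Rightarrow> bit" where
  "walk_sum \<phi> (x # y # xs) = \<phi> {x, y} + walk_sum \<phi> (y # xs)"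
| "walk_sum \<phi> _ = 0"

lemma walk_sum_append: "walk_sum \<phi> (xs @ z # ys) = walk_sum \<phi> (xs @ [z]) + walk_sum \<phi> (z # ys)"
proof (induction xs)
  case (Cons x xs)
  then show ?case by (cases xs) (auto simp: add.assoc)
qed simp

lemma walk_sum_conv_sum: "walk_sum \<phi> (x # xs) = (\<Sum>i<length xs. \<phi> {(x # xs) ! i, xs ! i})"
proof (induction xs arbitrary: x)
  case (Cons y ys)
  have "walk_sum \<phi> (x # y # ys) = \<phi> {x, y} + (\<Sum>i<length ys. \<phi> {(y # ys) ! i, ys ! i})"
    using Cons.IH[of y] by simp
  then show ?case by (simp add: sum.lessThan_Suc_shift del: sum.lessThan_Suc walk_sum.simps)
qed simp

lemma successively_split:
  "successively P (as @ y # bs) \<longleftrightarrow> successively P (as @ [y]) \<and> successively P (y # bs)"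
  by (auto simp: successively_append_iff)

lemma sum_cycle_edges:
  assumes "distinct xs" and n: "3 \<le> length xs"
  shows "(\<Sum>e\<in>cycle_edges xs. \<phi> e) = walk_sum \<phi> (xs @ [hd xs])"
proof -
  let ?n = "length xs"
  have ne: "xs \<noteq> []" using n by auto
  have m: "Suc i mod ?n = (if Suc i = ?n then 0 else Suc i)" if "i < ?n" for i
    using that by auto
  have "inj_on (\<lambda>i. {xs ! i, xs ! (Suc i mod ?n)}) {..<?n}"
  proof (rule inj_onI)
    fix i j assume ij: "i \<in> {..<?n}" "j \<in> {..<?n}"
      and eq: "{xs ! i, xs ! (Suc i mod ?n)} = {xs ! j, xs ! (Suc j mod ?n)}"
    have "0 < ?n" using n by linarith
    then have l: "Suc i mod ?n < ?n" "Suc j mod ?n < ?n" by (rule mod_less_divisor)+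
    have "i = j \<or> i = Suc j mod ?n \<and> Suc i mod ?n = j"
      using eq ij l assms(1) by (auto simp: doubleton_eq_iff nth_eq_iff_index_eq)
    then show "i = j" using ij n m[of i] m[of j] by (auto split: if_splits)
  qed
  moreover have "cycle_edges xs = (\<lambda>i. {xs ! i, xs ! (Suc i mod ?n)}) ` {..<?n}"
    by (auto simp: cycle_edges_def)
  ultimately have "(\<Sum>e\<in>cycle_edges xs. \<phi> e) = (\<Sum>i<?n. \<phi> {xs ! i, xs ! (Suc i mod ?n)})"
    by (simp add: sum.reindex)
  also have "\<dots> = walk_sum \<phi> (xs @ [hd xs])"
  proof -
    obtain x zs where xs: "xs = x # zs" using ne by (cases xs) auto
    have "{(x # zs @ [x]) ! i, (zs @ [x]) ! i} = {xs ! i, xs ! (Suc i mod ?n)}" if "i < ?n" for i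
      using that m[OF that] by (cases i) (auto simp: xs nth_append)
    then show ?thesis using walk_sum_conv_sum[of \<phi> x "zs @ [x]"] by (simp add: xs)
  qed
  finally show ?thesis .
qed

text \<open>If the weight of an edge is the difference of a potential at its ends, then the sum along a
  walk telescopes. With the indicator of a vertex set as potential this is the parity of the number of
  times that the walk crosses the boundary of the set.\<close>

lemma walk_sum_coboundary:
  assumes "xs \<noteq> []" and "successively (\<lambda>x y. \<phi> {x, y} = p x + p y) xs"
  shows "walk_sum \<phi> xs = p (hd xs) + p (last xs)"
  using assms
proof (induction \<phi> xs rule: walk_sum.induct)
  case (1 \<phi> x y xs)
  then have "walk_sum \<phi> (x # y # xs) = p x + p y + (p y + p (last (y # xs)))" by simp
  then show ?case by (cases "p y") auto
qed auto

lemma successively_cycle: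
  assumes "is_cycle V E xs"
  shows "successively (\<lambda>x y. {x, y} \<in> E) (xs @ [hd xs])"
proof -
  have n: "xs \<noteq> []" and sub: "cycle_edges xs \<subseteq> E" using assms by (auto simp: is_cycle_def)
  have "{(xs @ [hd xs]) ! i, (xs @ [hd xs]) ! Suc i} \<in> E" if i: "i < length xs" for i
  proof -
    have "(xs @ [hd xs]) ! Suc i = xs ! (Suc i mod length xs)"
      using i n by (cases "Suc i = length xs") (auto simp: nth_append hd_conv_nth)
    then show ?thesis using i sub by (auto simp: nth_append cycle_edges_def)
  qed
  then show ?thesis by (auto simp: successively_conv_nth)
qed

lemma is_cycle_if_successively:
  assumes "3 \<le> length xs" "distinct xs" "set xs \<subseteq> V"
    and s: "successively (\<lambda>x y. {x, y} \<in> E) xs" and e: "{last xs, hd xs} \<in> E"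
  shows "is_cycle V E xs"
proof -
  have "{xs ! i, xs ! (Suc i mod length xs)} \<in> E" if i: "i < length xs" for i
  proof (cases "Suc i = length xs")
    case True
    then have "i = length xs - 1" "xs \<noteq> []" by auto
    then show ?thesis using True e by (auto simp: last_conv_nth hd_conv_nth)
  next
    case False
    then show ?thesis using i s by (auto simp: successively_conv_nth)
  qed
  then show ?thesis using assms by (auto simp: is_cycle_def cycle_edges_def)
qed

text \<open>A closed walk is taken apart into cycles: at a repeated vertex it splits into two shorter
  closed walks. If no vertex repeats, it is a cycle unless it has length at most two, and then it runs
  along one edge forth and back. The list \<open>xs\<close> leaves out the final return to \<open>hd xs\<close>.\<close>

lemma walk_sum_closed_zero:
  assumes G: "simple_graph V E"
    and cyc: "\<And>zs. is_cycle V E zs \<Longrightarrow> walk_sum \<phi> (zs @ [hd zs]) = 0"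
  shows "xs \<noteq> [] \<Longrightarrow> set xs \<subseteq> V \<Longrightarrow> successively (\<lambda>x y. {x, y} \<in> E) (xs @ [hd xs])
      \<Longrightarrow> walk_sum \<phi> (xs @ [hd xs]) = 0"
proof (induction "length xs" arbitrary: xs rule: less_induct)
  case less
  show ?case
  proof (cases "distinct xs")
    case True
    have "0 < length xs" using less.prems(1) by simp
    then have "length xs = 1 \<or> length xs = 2 \<or> 3 \<le> length xs" by linarith
    then consider "length xs = 1" | "length xs = 2" | "3 \<le> length xs" by blast
    then show ?thesis
    proof cases
      case 1
      then obtain x where "xs = [x]" by (auto simp: length_Suc_conv)
      then have "{x} \<in> E" using less.prems by simp
      then show ?thesis using G by (auto simp: simple_graph_def)
    next
      case 2
      then obtain x y where "xs = [x, y]"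
        by (auto simp: numeral_2_eq_2 length_Suc_conv)
      then show ?thesis by (simp add: insert_commute)
    next
      case 3
      then have "is_cycle V E xs"
        using True less.prems by (intro is_cycle_if_successively) (auto simp: successively_append_iff)
      then show ?thesis by (rule cyc)
    qed
  next
    case False
    then obtain as y bs cs where xs: "xs = as @ [y] @ bs @ [y] @ cs"
      using not_distinct_decomp by blast
    let ?h = "hd (as @ [y])"
    have h: "hd xs = ?h" "hd (as @ y # cs) = ?h" by (cases as; simp add: xs)+
    have w: "successively (\<lambda>x y. {x, y} \<in> E) (as @ y # bs @ y # cs @ [?h])"
      using less.prems(3) by (simp add: h(1)) (simp add: xs)
    have w1: "successively (\<lambda>x y. {x, y} \<in> E) (as @ [y])"
      and "successively (\<lambda>x y. {x, y} \<in> E) ((y # bs) @ y # cs @ [?h])"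
      using successively_split[of _ as y "bs @ y # cs @ [?h]"] w by auto
    then have w2: "successively (\<lambda>x y. {x, y} \<in> E) ((y # bs) @ [y])"
      and w3: "successively (\<lambda>x y. {x, y} \<in> E) (y # cs @ [?h])"
      using successively_split[of _ "y # bs" y "cs @ [?h]"] by auto
    have w4: "successively (\<lambda>x y. {x, y} \<in> E) (as @ y # cs @ [?h])"
      using w1 w3 successively_split[of _ as y "cs @ [?h]"] by blast
    have 1: "walk_sum \<phi> ((y # bs) @ [hd (y # bs)]) = 0"
      by (rule less.hyps) (use w2 less.prems(2) in \<open>simp_all add: xs\<close>)
    have 2: "walk_sum \<phi> ((as @ y # cs) @ [hd (as @ y # cs)]) = 0"
      by (rule less.hyps) (use w4 less.prems(2) in \<open>simp_all add: xs h(2)\<close>)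
    have "walk_sum \<phi> (xs @ [hd xs]) = walk_sum \<phi> (as @ y # bs @ y # cs @ [?h])"
      by (simp add: h(1)) (simp add: xs)
    also have "\<dots> = walk_sum \<phi> (as @ [y]) + (walk_sum \<phi> ((y # bs) @ [y]) + walk_sum \<phi> (y # cs @ [?h]))"
      using walk_sum_append[of \<phi> as y "bs @ y # cs @ [?h]"]
        walk_sum_append[of \<phi> "y # bs" y "cs @ [?h]"] by simp
    also have "\<dots> = walk_sum \<phi> (as @ y # cs @ [?h])"
      using 1 walk_sum_append[of \<phi> as y "cs @ [?h]"] by simp
    also have "\<dots> = 0" using 2 by (simp add: h)
    finally show ?thesis .
  qed
qed

lemma finite_edges: "simple_graph V E \<Longrightarrow> finite E"
  by (rule finite_subset[of _ "Pow V"]) (auto simp: simple_graph_def)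

text \<open>Summing edge weights is a linear functional on edge vectors, so it vanishes on the whole
  cycle space as soon as it vanishes on generators.\<close>

lemma walk_sum_zero_of_generating_cycles:
  assumes G: "simple_graph V E"
    and gen: "edge_space.span {cycle_vector xs | xs. is_cycle V E xs \<and> length xs \<le> l}
                = cycle_space V E"
    and short: "\<And>xs. is_cycle V E xs \<Longrightarrow> length xs \<le> l \<Longrightarrow> walk_sum \<phi> (xs @ [hd xs]) = 0"
    and xs: "is_cycle V E xs"
  shows "walk_sum \<phi> (xs @ [hd xs]) = 0"
proof -
  define \<Phi> where "\<Phi> f = (\<Sum>e\<in>E. \<phi> e * f e)" for f
  have \<Phi>: "\<Phi> (cycle_vector zs) = walk_sum \<phi> (zs @ [hd zs])" if "is_cycle V E zs" for zs
  proof -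
    have "cycle_edges zs \<subseteq> E" using that by (auto simp: is_cycle_def)
    then have "\<Phi> (cycle_vector zs) = (\<Sum>e\<in>cycle_edges zs. \<phi> e)"
      using finite_edges[OF G] unfolding \<Phi>_def cycle_vector_def
      by (intro sum.mono_neutral_cong_right) (auto simp: indicator_def)
    then show ?thesis using that by (simp add: sum_cycle_edges is_cycle_def)
  qed
  have subspace: "edge_space.subspace {f. \<Phi> f = 0}"
  proof -
    have "\<Phi> (f + g) = \<Phi> f + \<Phi> g" for f g
      by (simp add: \<Phi>_def distrib_left sum.distrib)
    moreover have "\<Phi> (edge_scale c f) = c * \<Phi> f" for c f
      by (simp add: \<Phi>_def edge_scale_def sum_distrib_left mult.left_commute)
    moreover have "\<Phi> 0 = 0" by (simp add: \<Phi>_def)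
    ultimately show ?thesis by (auto simp: edge_space.subspace_def)
  qed
  have "{cycle_vector zs | zs. is_cycle V E zs \<and> length zs \<le> l} \<subseteq> {f. \<Phi> f = 0}"
  proof
    fix f assume "f \<in> {cycle_vector zs | zs. is_cycle V E zs \<and> length zs \<le> l}"
    then obtain zs where zs: "f = cycle_vector zs" "is_cycle V E zs" "length zs \<le> l" by blast
    show "f \<in> {f. \<Phi> f = 0}" using \<Phi>[OF zs(2)] short[OF zs(2,3)] by (simp add: zs(1))
  qed
  from edge_space.span_minimal[OF this subspace]
  have "cycle_space V E \<subseteq> {f. \<Phi> f = 0}" by (simp only: gen)
  moreover have "cycle_vector xs \<in> cycle_space V E"
    unfolding cycle_space_def using xs by (intro edge_space.span_base) auto
  ultimately have "\<Phi> (cycle_vector xs) = 0" by blast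
  then show ?thesis using \<Phi>[OF xs] by simp
qed

text \<open>Let \<open>C\<close> be the component of \<open>u\<close> in \<open>G - (A \<union> B)\<close>, and give weight one to the edges between
  \<open>C\<close> and \<open>A\<close>. A short cycle that misses \<open>A\<close> contains no such edge. A short cycle that meets \<open>A\<close>
  misses \<open>B\<close>, so it can leave \<open>C\<close> only into \<open>A\<close>, and as it leaves and enters \<open>C\<close> equally often, its
  weights sum to zero. Hence the weights of every closed walk sum to zero, in particular for a
  \<open>u\<close>-\<open>v\<close> path avoiding \<open>A\<close> followed by a path back that avoids \<open>B\<close>. The first path has
  sum zero. So the second one, which can leave \<open>C\<close> only into \<open>A\<close>, crosses the boundary of \<open>C\<close> an even
  number of times, and \<open>v\<close> lies in \<open>C\<close>.\<close>

lemma joined_avoiding_Un_if_far: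
  assumes G: "simple_graph V E"
    and gen: "edge_space.span {cycle_vector xs | xs. is_cycle V E xs \<and> length xs \<le> l}
                = cycle_space V E"
    and far: "\<And>xs. is_cycle V E xs \<Longrightarrow> length xs \<le> l \<Longrightarrow> set xs \<inter> A = {} \<or> set xs \<inter> B = {}"
    and A: "joined E (V - A) u v" and B: "joined E (V - B) u v"
  shows "joined E (V - (A \<union> B)) u v"
proof -
  let ?S = "V - (A \<union> B)"
  define C where "C = {x. joined E ?S u x}"
  define p :: "'a \<Rightarrow> bit" where "p = indicator C"
  define \<phi> :: "'a set \<Rightarrow> bit" where "\<phi> e = (if e \<inter> C \<noteq> {} \<and> e \<inter> A \<noteq> {} then 1 else 0)" for e
  have CS: "C \<subseteq> ?S" by (auto simp: C_def dest: joined_in(2))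
  have "u \<in> ?S" using joined_in(1)[OF A] joined_in(1)[OF B] by blast
  then have u: "u \<in> C" by (simp add: C_def joined_refl)
  have noA: "walk_sum \<phi> xs = 0" if "set xs \<inter> A = {}" for xs
    using that
  proof (induction xs)
    case (Cons x xs)
    then show ?case by (cases xs) (auto simp: \<phi>_def)
  qed simp
  have noB: "walk_sum \<phi> xs = p (hd xs) + p (last xs)"
    if "xs \<noteq> []" "set xs \<inter> B = {}" "successively (\<lambda>x y. {x, y} \<in> E) xs" for xs
  proof (rule walk_sum_coboundary[OF that(1)])
    have *: "y \<in> C" if "{x, y} \<in> E" "x \<in> C" "y \<notin> A" "y \<notin> B" for x y
    proof -
      have "joined E ?S x y" using that CS G by (intro joined_edge) (auto simp: simple_graph_def)
      then show ?thesis using joined_trans[of E ?S u x y] that(2) by (simp add: C_def)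
    qed
    have "\<phi> {x, y} = p x + p y" if xy: "{x, y} \<in> E" "x \<notin> B" "y \<notin> B" for x y
    proof -
      have "{y, x} \<in> E" using xy(1) by (simp add: insert_commute)
      then consider "x \<in> C" "y \<in> C" | "x \<in> C" "y \<notin> C" "y \<in> A"
        | "x \<notin> C" "y \<in> C" "x \<in> A" | "x \<notin> C" "y \<notin> C"
        using *[of x y] *[of y x] xy by blast
      then show ?thesis
      proof cases
        case 1
        then have "x \<notin> A" "y \<notin> A" using CS by auto
        with 1 show ?thesis by (simp add: \<phi>_def p_def)
      qed (simp_all add: \<phi>_def p_def)
    qed
    then show "successively (\<lambda>x y. \<phi> {x, y} = p x + p y) xs"
      using that(2) by (intro successively_mono[OF that(3)]) auto
  qed
  have short: "walk_sum \<phi> (xs @ [hd xs]) = 0" if "is_cycle V E xs" "length xs \<le> l" for xs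
  proof -
    have ne: "xs \<noteq> []" using that by (auto simp: is_cycle_def)
    then have s: "set (xs @ [hd xs]) = set xs" by auto
    show ?thesis
    proof (cases "set xs \<inter> A = {}")
      case True
      then show ?thesis by (intro noA) (simp only: s)
    next
      case False
      then have "set xs \<inter> B = {}" using far that by blast
      then have "walk_sum \<phi> (xs @ [hd xs]) = p (hd (xs @ [hd xs])) + p (last (xs @ [hd xs]))"
        using successively_cycle[OF that(1)] s by (intro noB) auto
      then show ?thesis using ne by simp
    qed
  qed
  have cyc: "walk_sum \<phi> (xs @ [hd xs]) = 0" if "is_cycle V E xs" for xs
    using walk_sum_zero_of_generating_cycles[OF G gen short that] .
  obtain P where P: "P \<noteq> []" "hd P = u" "last P = v" "set P \<subseteq> V - A"
      "successively (\<lambda>x y. {x, y} \<in> E) P"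
    using joined_path[OF A] by blast
  obtain Q where Q: "Q \<noteq> []" "hd Q = v" "last Q = u" "set Q \<subseteq> V - B"
      "successively (\<lambda>x y. {x, y} \<in> E) Q"
    using joined_path[OF joined_sym[OF B]] by blast
  obtain P' where P': "P = P' @ [v]" using P by (metis append_butlast_last_id)
  obtain Q' where Q': "Q = Q' @ [u]" using Q by (metis append_butlast_last_id)
  show ?thesis
  proof (cases "P' = [] \<or> Q' = []")
    case True
    then have "u = v" using P Q P' Q' by auto
    then show ?thesis using u by (simp add: C_def)
  next
    case False
    then obtain Q'' where Q'': "Q' = v # Q''" using Q Q' by (cases Q') auto
    have h: "hd (P' @ Q') = u" using P P' False by (cases P') auto
    have "walk_sum \<phi> ((P' @ Q') @ [hd (P' @ Q')]) = 0"
    proof (rule walk_sum_closed_zero[OF G cyc])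
      show "successively (\<lambda>x y. {x, y} \<in> E) ((P' @ Q') @ [hd (P' @ Q')])"
        unfolding h using P(5) Q(5) unfolding P' Q' Q''
        by (auto simp: successively_append_iff)
    qed (use False P Q P' Q' in auto)
    then have "walk_sum \<phi> P + walk_sum \<phi> Q = 0"
      unfolding h using walk_sum_append[of \<phi> P' v "Q'' @ [u]"] by (simp add: P' Q' Q'')
    moreover have "walk_sum \<phi> P = 0" using P by (intro noA) auto
    moreover have "walk_sum \<phi> Q = p v + p u" using noB[of Q] Q by auto
    ultimately have "v \<in> C" using u by (cases "v \<in> C") (auto simp: p_def)
    then show ?thesis by (simp add: C_def)
  qed
qed

section \<open>Havens and tree-decompositions\<close>

lemma joined_remove_edge: "joined F S a b \<Longrightarrow> \<not> e \<subseteq> S \<Longrightarrow> joined (F - {e}) S a b"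
proof -
  assume "\<not> e \<subseteq> S"
  then have "induced_edges (F - {e}) S = induced_edges F S" by (auto simp: induced_edges_def)
  then show "joined F S a b \<Longrightarrow> joined (F - {e}) S a b" by (simp add: joined_def)
qed

lemma tree_edge_is_bridge:
  assumes T: "is_tree N F" and e: "{s, t} \<in> F" "s \<noteq> t"
  shows "\<not> joined (F - {{s, t}}) N s t"
proof
  assume "joined (F - {{s, t}}) N s t"
  then obtain xs where xs: "xs \<noteq> []" "hd xs = s" "last xs = t" "set xs \<subseteq> N" "distinct xs"
    and w: "successively (\<lambda>x y. {x, y} \<in> F - {{s, t}}) xs"
    using joined_path by metis
  have "length xs \<noteq> 1" using xs(2,3) e(2) by (auto simp: length_Suc_conv)
  moreover have "length xs \<noteq> 2"
  proof
    assume "length xs = 2"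
    then obtain a b where "xs = [a, b]" by (auto simp: numeral_2_eq_2 length_Suc_conv)
    then show False using xs(2,3) w by simp
  qed
  moreover have "length xs \<noteq> 0" using xs(1) by simp
  ultimately have "3 \<le> length xs" by linarith
  moreover have "successively (\<lambda>x y. {x, y} \<in> F) xs"
    by (rule successively_mono[OF w]) simp
  moreover have "{last xs, hd xs} \<in> F" using xs(2,3) e(1) by (simp add: insert_commute)
  ultimately have "is_cycle N F xs" using xs(4,5) by (intro is_cycle_if_successively)
  then show False using T by (auto simp: is_tree_def)
qed

text \<open>Start at any node and iterate \<open>f\<close>. As the tree is finite, some orbit closes up. A shortest
  period of length at least three would be a cycle of the tree, and period one would be a loop.\<close>

lemma tree_map_swaps_edge:
  assumes T: "is_tree N F" and f: "\<And>t. t \<in> N \<Longrightarrow> f t \<in> N \<and> {t, f t} \<in> F"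
  shows "\<exists>t\<in>N. f (f t) = t"
proof -
  have fin: "finite N" and "N \<noteq> {}" and edge: "\<And>e. e \<in> F \<Longrightarrow> card e = 2"
    using T by (auto simp: is_tree_def simple_graph_def connected_graph_def)
  then obtain x where x: "x \<in> N" by blast
  have iter: "(f ^^ i) y \<in> N" if "y \<in> N" for i y
    using that f by (induction i) auto
  have "\<not> inj (\<lambda>i. (f ^^ i) x)"
  proof
    assume "inj (\<lambda>i. (f ^^ i) x)"
    moreover have "finite (range (\<lambda>i. (f ^^ i) x))"
      by (rule finite_subset[OF _ fin]) (use iter[OF x] in auto)
    ultimately show False using finite_imageD by blast
  qed
  then obtain i j where ij: "i < j" "(f ^^ i) x = (f ^^ j) x"
    unfolding inj_def by (metis linorder_neqE_nat)
  define y where "y = (f ^^ i) x"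
  have y: "y \<in> N" using iter[OF x] by (simp add: y_def)
  have "(f ^^ (j - i + i)) x = (f ^^ (j - i)) y" by (simp only: funpow_add o_apply y_def)
  then have ex: "0 < j - i \<and> (f ^^ (j - i)) y = y" using ij by (simp add: y_def)
  define k where "k = (LEAST k. 0 < k \<and> (f ^^ k) y = y)"
  have k: "0 < k" "(f ^^ k) y = y"
    unfolding k_def using LeastI[of "\<lambda>k. 0 < k \<and> (f ^^ k) y = y", OF ex] by auto
  have min: "(f ^^ m) y \<noteq> y" if "0 < m" "m < k" for m
    using that not_less_Least[of m "\<lambda>k. 0 < k \<and> (f ^^ k) y = y"] unfolding k_def by blast
  have neq: "(f ^^ a) y \<noteq> (f ^^ b) y" if "a < b" "b < k" for a b
  proof
    assume eq: "(f ^^ a) y = (f ^^ b) y"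
    have "(f ^^ (k - b + a)) y = (f ^^ (k - b)) ((f ^^ a) y)" by (simp only: funpow_add o_apply)
    also have "\<dots> = (f ^^ (k - b + b)) y" by (simp only: eq funpow_add o_apply)
    also have "\<dots> = y" using that k by simp
    finally have eqy: "(f ^^ (k - b + a)) y = y" .
    have "0 < k - b + a" "k - b + a < k" using that by linarith+
    from min[OF this] eqy show False by contradiction
  qed
  have "k \<noteq> 1"
  proof
    assume "k = 1"
    then have "{y} \<in> F" using f[OF y] k by simp
    then show False using edge[of "{y}"] by simp
  qed
  moreover have "\<not> 3 \<le> k"
  proof
    assume k3: "3 \<le> k"
    let ?xs = "map (\<lambda>i. (f ^^ i) y) [0..<k]"
    have "is_cycle N F ?xs"
    proof (rule is_cycle_if_successively)
      show "distinct ?xs"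
        unfolding distinct_map
      proof (intro conjI inj_onI)
        fix a b assume ab: "a \<in> set [0..<k]" "b \<in> set [0..<k]" "(f ^^ a) y = (f ^^ b) y"
        show "a = b"
          using ab neq[of a b] neq[of b a] by (cases a b rule: linorder_cases) auto
      qed simp
      show "successively (\<lambda>x y. {x, y} \<in> F) ?xs"
        using f iter[OF y] by (auto simp: successively_conv_nth)
      obtain m where m: "k = Suc m" using k(1) by (cases k) auto
      have "last ?xs = (f ^^ m) y" using m by simp
      moreover have "hd ?xs = y" using m by (simp add: hd_map del: upt_Suc)
      ultimately show "{last ?xs, hd ?xs} \<in> F" using f[OF iter[OF y, of m]] k(2) m by simp
    qed (use k3 iter[OF y] in auto)
    then show False using T by (auto simp: is_tree_def)
  qed
  ultimately have "k = 2" using k(1) by linarith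
  then have "f (f y) = y" using k(2) by (simp add: numeral_2_eq_2)
  then show ?thesis using y by blast
qed

lemma joined_first_step:
  assumes "joined F N t s"
  shows "s = t \<or> (\<exists>t'. {t, t'} \<in> F \<and> joined F (N - {t}) t' s)"
  using assms
proof (induction rule: joined_induct)
  case (step x y)
  show ?case
  proof (cases "y = t")
    case False
    note y = this
    show ?thesis
    proof (cases "x = t")
      case True
      then have "joined F (N - {t}) y y" using step.hyps y by (intro joined_refl) simp
      then show ?thesis using True step.hyps by blast
    next
      case False
      then obtain t' where t': "{t, t'} \<in> F" "joined F (N - {t}) t' x" using step.IH by blast
      have "joined F (N - {t}) x y" using step.hyps False y by (intro joined_edge) auto
      then show ?thesis using t' joined_trans[OF t'(2)] by blast
    qed
  qed simp
qed simp

text \<open>For every node \<open>t\<close> the nodes whose parts meet \<open>D (P t)\<close> lie in one component of the tree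
  minus \<open>t\<close>, because \<open>D (P t)\<close> can be traversed avoiding \<open>P t\<close>;
  let \<open>f t\<close> be the neighbour of \<open>t\<close> in that component. Some edge has \<open>f t = t'\<close> and \<open>f t' = t\<close>.
  By monotonicity \<open>D (P t)\<close> and \<open>D (P t')\<close> both lie in \<open>D (P t \<inter> P t')\<close>, which can be
  traversed avoiding \<open>P t \<inter> P t'\<close>. But a vertex outside \<open>P t \<inter> P t'\<close> has a subtree that does
  not contain the edge from \<open>t\<close> to \<open>t'\<close>, so that edge would not be a bridge.\<close>

lemma haven_contradicts_tree_decomposition:
  assumes td: "tree_decomposition V E N F P"
    and small: "\<And>t. t \<in> N \<Longrightarrow> card (P t) \<le> m"
    and fin: "finite V"
    and ne: "\<And>X. X \<subseteq> V \<Longrightarrow> card X \<le> m \<Longrightarrow> D X \<noteq> {}"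
    and joined: "\<And>X u v. X \<subseteq> V \<Longrightarrow> card X \<le> m \<Longrightarrow> u \<in> D X \<Longrightarrow> v \<in> D X \<Longrightarrow> joined E (V - X) u v"
    and mono: "\<And>X Y. Y \<subseteq> V \<Longrightarrow> card Y \<le> m \<Longrightarrow> X \<subseteq> Y \<Longrightarrow> D Y \<subseteq> D X"
  shows False
proof -
  have T: "is_tree N F" and PV: "\<And>t. t \<in> N \<Longrightarrow> P t \<subseteq> V"
    and cov: "\<And>e. e \<in> E \<Longrightarrow> \<exists>t\<in>N. e \<subseteq> P t"
    using td by (auto simp: tree_decomposition_def)
  have treeN: "\<And>s t. s \<in> N \<Longrightarrow> t \<in> N \<Longrightarrow> joined F N s t"
    and edge: "\<And>e. e \<in> F \<Longrightarrow> card e = 2 \<and> e \<subseteq> N"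
  proof -
    have "connected_set N F N" "simple_graph N F"
      using T by (auto simp: is_tree_def connected_set_def simple_graph_def induced_edges_def
          intro: back_subst[of "connected_graph N"])
    then show "\<And>s t. s \<in> N \<Longrightarrow> t \<in> N \<Longrightarrow> joined F N s t" "\<And>e. e \<in> F \<Longrightarrow> card e = 2 \<and> e \<subseteq> N"
      by (auto simp: connected_set_iff_joined simple_graph_def)
  qed
  define T where "T v = {t \<in> N. v \<in> P t}" for v
  have Tconn: "connected_set N F (T v)" if "v \<in> V" for v
    using td that by (auto simp: tree_decomposition_def T_def)
  (* A walk in the graph induces a walk in the tree, because the subtrees of adjacent vertices
     intersect. The walk inherits every restriction that all these subtrees obey. *)
  have transfer: "joined F' N' a b"
    if "joined E S u v" "S \<subseteq> V" and a: "a \<in> T u"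
      and loc: "\<And>x c d. x \<in> S \<Longrightarrow> c \<in> T x \<Longrightarrow> d \<in> T x \<Longrightarrow> joined F (T x) c d \<Longrightarrow> joined F' N' c d"
      and b: "b \<in> T v"
    for F' N' S u v a b
  proof -
    have loc': "joined F' N' c d" if "x \<in> S" "c \<in> T x" "d \<in> T x" for x c d
      using loc[OF that] Tconn[of x] that \<open>S \<subseteq> V\<close> by (auto simp: connected_set_iff_joined)
    have "\<forall>b\<in>T v. joined F' N' a b"
      using that(1)
    proof (induction rule: joined_induct)
      case refl
      then show ?case using loc' a joined_in(1)[OF that(1)] by blast
    next
      case (step x y)
      obtain s where s: "s \<in> T x" "s \<in> T y" using cov[OF step.hyps(2)] by (auto simp: T_def)
      show ?case
        using joined_trans[of F' N' a s] step.IH s loc'[OF step.hyps(4) s(2)] by blast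
    qed
    then show ?thesis using b by blast
  qed
  have "\<exists>t'. t' \<in> N \<and> {t, t'} \<in> F \<and> (\<forall>v\<in>D (P t). \<forall>s\<in>T v. joined F (N - {t}) t' s)"
    if t: "t \<in> N" for t
  proof -
    note Pt = PV[OF t] small[OF t]
    obtain v0 where v0: "v0 \<in> D (P t)" using ne[OF Pt] by blast
    then have v0V: "v0 \<in> V - P t" using joined[OF Pt v0 v0] joined_in by metis
    then obtain s0 where s0: "s0 \<in> T v0" using Tconn[of v0] by (auto simp: connected_set_iff_joined)
    then have "s0 \<in> N" "s0 \<noteq> t" using v0V by (auto simp: T_def)
    then obtain t' where t': "{t, t'} \<in> F" "joined F (N - {t}) t' s0"
      using joined_first_step[OF treeN[OF t]] by blast
    have "joined F (N - {t}) t' s" if v: "v \<in> D (P t)" and s: "s \<in> T v" for v s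
    proof (rule joined_trans[OF t'(2)])
      show "joined F (N - {t}) s0 s"
      proof (rule transfer[OF joined[OF Pt v0 v] _ s0 _ s])
        fix x c d assume x: "x \<in> V - P t" and j: "joined F (T x) c d"
        have "T x \<subseteq> N - {t}" using x by (auto simp: T_def)
        then show "joined F (N - {t}) c d" by (rule joined_mono[OF j _ order_refl])
      qed simp
    qed
    then show ?thesis using t' edge[OF t'(1)] by auto
  qed
  then obtain f where f: "\<And>t. t \<in> N \<Longrightarrow> f t \<in> N \<and> {t, f t} \<in> F"
    and toward: "\<And>t v s. t \<in> N \<Longrightarrow> v \<in> D (P t) \<Longrightarrow> s \<in> T v \<Longrightarrow> joined F (N - {t}) (f t) s"
    by metis
  obtain t where t: "t \<in> N" "f (f t) = t" using tree_map_swaps_edge[OF \<open>is_tree N F\<close>, of f] f by blast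
  define t' where "t' = f t"
  have t': "t' \<in> N" "f t' = t" "{t, t'} \<in> F" using f t by (auto simp: t'_def)
  have "t \<noteq> t'" using edge[OF t'(3)] by auto
  let ?A = "P t \<inter> P t'" and ?F = "F - {{t, t'}}"
  have A: "?A \<subseteq> V" "card ?A \<le> m"
    using PV[OF t(1)] small[OF t(1)] card_mono[of "P t" ?A] finite_subset[OF _ fin, of "P t"] by auto
  obtain v v' where v: "v \<in> D (P t)" "v' \<in> D (P t')"
    using ne PV small t(1) t'(1) by (metis equals0I)
  have vA: "v \<in> D ?A" "v' \<in> D ?A"
    using v mono[of "P t" ?A] mono[of "P t'" ?A] PV small t(1) t'(1) by auto
  have jA: "joined E (V - ?A) v v'" using joined[OF A vA] .
  then have "v \<in> V" "v' \<in> V" using joined_in by (metis DiffD1)+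
  then obtain s s' where s: "s \<in> T v" "s' \<in> T v'"
    using Tconn[of v] Tconn[of v'] by (auto simp: connected_set_iff_joined)
  have 1: "joined ?F N s s'"
  proof (rule transfer[OF jA _ s(1) _ s(2)])
    fix x c d assume x: "x \<in> V - ?A" and j: "joined F (T x) c d"
    have ne: "\<not> {t, t'} \<subseteq> T x" and N: "T x \<subseteq> N" using x by (auto simp: T_def)
    show "joined ?F N c d"
      by (rule joined_mono[OF joined_remove_edge[OF j ne] N order_refl])
  qed simp
  have 2: "joined ?F N t' s"
    by (rule joined_mono[OF joined_remove_edge[OF toward[OF t(1) v(1) s(1), folded t'_def], of "{t, t'}"]]) auto
  have 3: "joined ?F N t s'"
    by (rule joined_mono[OF joined_remove_edge[OF toward[OF t'(1) v(2) s(2), unfolded t'(2)], of "{t, t'}"]]) auto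
  have "joined ?F N t t'"
    by (rule joined_trans[OF 3 joined_trans[OF joined_sym[OF 1] joined_sym[OF 2]]])
  then show False using tree_edge_is_bridge[OF \<open>is_tree N F\<close> t'(3) \<open>t \<noteq> t'\<close>] by blast
qed

section \<open>Closeness and clusters\<close>

text \<open>Distance at most \<open>k\<close>, expressed by the vertex set of a connecting path. In this form the
  witness of nearness can be united directly with other connected sets.\<close>

definition near :: "'a set \<Rightarrow> 'a set set \<Rightarrow> nat \<Rightarrow> 'a \<Rightarrow> 'a \<Rightarrow> bool" where
  "near V E k x y \<longleftrightarrow> (\<exists>S. connected_set V E S \<and> card S \<le> k + 1 \<and> x \<in> S \<and> y \<in> S)"

lemma near_sym: "near V E k x y \<Longrightarrow> near V E k y x"
  by (auto simp: near_def)

lemma near_edge: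
  assumes "{x, y} \<in> E" "x \<in> V" "y \<in> V" "1 \<le> k"
  shows "near V E k x y"
proof -
  have "joined E {x, y} x y" using assms by (intro joined_edge) auto
  then have "connected_set V E {x, y}"
    using assms joined_sym by (auto simp: connected_set_iff_joined joined_refl)
  moreover have "card {x, y} \<le> k + 1"
    using assms by (cases "x = y") auto
  ultimately show ?thesis unfolding near_def by blast
qed

lemma arc_connected:
  assumes c: "is_cycle V E xs"
  shows "connected_set V E ((\<lambda>j. xs ! ((i + j) mod length xs)) ` {..m})"
proof -
  let ?n = "length xs" and ?S = "(\<lambda>j. xs ! ((i + j) mod length xs)) ` {..m}"
  have n: "0 < ?n" and V: "set xs \<subseteq> V" and E: "cycle_edges xs \<subseteq> E"
    using c by (auto simp: is_cycle_def)
  have e: "{xs ! (a mod ?n), xs ! (Suc a mod ?n)} \<in> E" for a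
  proof -
    have "a mod ?n < ?n" using n by simp
    then have "{xs ! (a mod ?n), xs ! (Suc (a mod ?n) mod ?n)} \<in> cycle_edges xs"
      unfolding cycle_edges_def by blast
    then show ?thesis using E by (auto simp: mod_Suc_eq)
  qed
  have start: "joined E ?S (xs ! (i mod ?n)) (xs ! ((i + j) mod ?n))" if "j \<le> m" for j
    using that
  proof (induction j)
    case 0
    have "xs ! (i mod ?n) \<in> ?S" by (rule image_eqI[of _ _ 0]) auto
    then show ?case by (simp add: joined_refl)
  next
    case (Suc j)
    have "joined E ?S (xs ! ((i + j) mod ?n)) (xs ! ((i + Suc j) mod ?n))"
    proof (rule joined_edge)
      show "{xs ! ((i + j) mod ?n), xs ! ((i + Suc j) mod ?n)} \<in> E" using e[of "i + j"] by simp
      show "xs ! ((i + j) mod ?n) \<in> ?S" using Suc.prems by (intro imageI) simp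
      show "xs ! ((i + Suc j) mod ?n) \<in> ?S" using Suc.prems by (intro imageI) simp
    qed
    moreover have "joined E ?S (xs ! (i mod ?n)) (xs ! ((i + j) mod ?n))"
      using Suc by simp
    ultimately show ?case by (rule joined_trans[rotated])
  qed
  have "joined E ?S u v" if uv: "u \<in> ?S" "v \<in> ?S" for u v
  proof -
    obtain a b where "a \<le> m" "u = xs ! ((i + a) mod ?n)" "b \<le> m" "v = xs ! ((i + b) mod ?n)"
      using uv by auto
    then show ?thesis using joined_trans[OF joined_sym[OF start[of a]] start[of b]] by simp
  qed
  moreover have "?S \<subseteq> V"
  proof
    fix u assume "u \<in> ?S"
    then obtain a where "u = xs ! ((i + a) mod ?n)" by auto
    moreover have "(i + a) mod ?n < ?n" using n by simp
    ultimately show "u \<in> V" using V by auto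
  qed
  moreover have "?S \<noteq> {}" by auto
  ultimately show ?thesis unfolding connected_set_iff_joined by blast
qed

text \<open>One of the two arcs between the vertices has at most half of the length of the cycle.\<close>

lemma near_on_cycle:
  assumes c: "is_cycle V E xs" and x: "x \<in> set xs" and y: "y \<in> set xs"
    and k: "length xs div 2 \<le> k"
  shows "near V E k x y"
proof -
  let ?n = "length xs"
  have *: "near V E k (xs ! i) (xs ! ((i + m) mod ?n))" if "i < ?n" "m \<le> k" for i m
  proof -
    let ?S = "(\<lambda>j. xs ! ((i + j) mod ?n)) ` {..m}"
    have "card ?S \<le> k + 1" using card_image_le[of "{..m}" "\<lambda>j. xs ! ((i + j) mod ?n)"] that by simp
    moreover have "xs ! i \<in> ?S" using that by (intro image_eqI[of _ _ 0]) auto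
    moreover have "xs ! ((i + m) mod ?n) \<in> ?S" by (intro imageI) simp
    ultimately show ?thesis using arc_connected[OF c, of i m] unfolding near_def by blast
  qed
  have **: "near V E k (xs ! i) (xs ! j)" if "i \<le> j" "j < ?n" for i j
  proof (cases "j - i \<le> k")
    case True
    then show ?thesis using *[of i "j - i"] that by simp
  next
    case False
    then have "?n - (j - i) \<le> k" using k that by linarith
    moreover have "(j + (?n - (j - i))) mod ?n = i" using that by simp
    ultimately show ?thesis using *[of j "?n - (j - i)"] that by (simp add: near_sym)
  qed
  obtain i j where "i < ?n" "j < ?n" "x = xs ! i" "y = xs ! j"
    using x y by (auto simp: in_set_conv_nth)
  then show ?thesis using **[of i j] **[of j i] near_sym by (cases "i \<le> j") auto
qed

text \<open>The equivalence class of \<open>x\<close> under chains of near vertices of \<open>X\<close>. It is used for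
  \<open>x \<in> X\<close> only; otherwise it is \<open>{x}\<close>.\<close>

definition cluster :: "'a set \<Rightarrow> 'a set set \<Rightarrow> nat \<Rightarrow> 'a set \<Rightarrow> 'a \<Rightarrow> 'a set" where
  "cluster V E k X x = {y. (x, y) \<in> {(a, b). a \<in> X \<and> b \<in> X \<and> near V E k a b}\<^sup>*}"

lemma cluster_self: "x \<in> cluster V E k X x"
  by (simp add: cluster_def)

lemma cluster_step:
  "y \<in> cluster V E k X x \<Longrightarrow> y \<in> X \<Longrightarrow> z \<in> X \<Longrightarrow> near V E k y z \<Longrightarrow> z \<in> cluster V E k X x"
  unfolding cluster_def by (auto intro: rtrancl_into_rtrancl)

lemma cluster_induct [consumes 1, case_names refl step]:
  assumes "y \<in> cluster V E k X x" and "Q x"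
    and "\<And>y z. y \<in> cluster V E k X x \<Longrightarrow> Q y \<Longrightarrow> y \<in> X \<Longrightarrow> z \<in> X \<Longrightarrow> near V E k y z \<Longrightarrow> Q z"
  shows "Q y"
proof -
  have "(x, y) \<in> {(a, b). a \<in> X \<and> b \<in> X \<and> near V E k a b}\<^sup>*"
    using assms(1) by (simp add: cluster_def)
  then show ?thesis
  proof (induction rule: rtrancl_induct)
    case base
    show ?case by (rule assms(2))
  next
    case (step y z)
    then show ?case using assms(3)[of y z] by (simp add: cluster_def)
  qed
qed

lemma cluster_subset:
  assumes "x \<in> X"
  shows "cluster V E k X x \<subseteq> X"
proof
  fix y assume "y \<in> cluster V E k X x"
  then show "y \<in> X" by (induction rule: cluster_induct) (use assms in auto)
qed

lemma cluster_mono: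
  assumes "A \<subseteq> X"
  shows "cluster V E k A x \<subseteq> cluster V E k X x"
proof -
  have "{(a, b). a \<in> A \<and> b \<in> A \<and> near V E k a b} \<subseteq> {(a, b). a \<in> X \<and> b \<in> X \<and> near V E k a b}"
    using assms by auto
  from rtrancl_mono[OF this] show ?thesis unfolding cluster_def by blast
qed

lemma cluster_eq:
  assumes "y \<in> cluster V E k X x"
  shows "cluster V E k X y = cluster V E k X x"
proof -
  let ?R = "{(a, b). a \<in> X \<and> b \<in> X \<and> near V E k a b}"
  have "sym ?R" using near_sym by (auto simp: sym_def)
  then have s: "sym (?R\<^sup>*)" by (rule sym_rtrancl)
  have xy: "(x, y) \<in> ?R\<^sup>*" using assms by (simp add: cluster_def)
  then have yx: "(y, x) \<in> ?R\<^sup>*" using s by (rule symD[rotated])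
  show ?thesis
    unfolding cluster_def using rtrancl_trans[OF xy] rtrancl_trans[OF yx] by blast
qed

text \<open>Grow a part \<open>Z\<close> of the cluster inside a connected set \<open>S\<close>. While \<open>Z\<close> is not the whole
  cluster, some further vertex \<open>y\<close> of the cluster is near some \<open>z \<in> Z\<close>, and a connected set witnessing
  this shares \<open>z\<close> with \<open>S\<close>, so it adds at most \<open>k\<close> vertices.\<close>

lemma cluster_connected_hull:
  assumes fin: "finite V" and X: "X \<subseteq> V" "card X \<le> w + 1" and x: "x \<in> X"
  shows "\<exists>S. cluster V E k X x \<subseteq> S \<and> connected_set V E S \<and> card S \<le> w * k + 1"
proof -
  let ?K = "cluster V E k X x"
  have KX: "?K \<subseteq> X" using x by (rule cluster_subset)
  have finK: "finite ?K" using KX X(1) fin finite_subset by metis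
  have grow: "\<exists>Z S. Z \<subseteq> ?K \<and> x \<in> Z \<and> card Z = Suc n \<and> Z \<subseteq> S \<and> connected_set V E S
      \<and> card S \<le> n * k + 1" if "n < card ?K" for n
    using that
  proof (induction n)
    case 0
    have "connected_set V E {x}" using x X by (auto simp: connected_set_iff_joined joined_refl)
    then show ?case by (intro exI[of _ "{x}"]) (auto simp: cluster_self)
  next
    case (Suc n)
    then obtain Z S where Z: "Z \<subseteq> ?K" "x \<in> Z" "card Z = Suc n"
      and S: "Z \<subseteq> S" "connected_set V E S" "card S \<le> n * k + 1" by auto
    have "\<not> ?K \<subseteq> Z" using Z Suc.prems by auto
    have "\<exists>z\<in>Z. \<exists>y\<in>?K - Z. near V E k z y"
    proof (rule ccontr)
      assume none: "\<not> (\<exists>z\<in>Z. \<exists>y\<in>?K - Z. near V E k z y)"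
      have "?K \<subseteq> Z"
      proof
        fix y assume "y \<in> ?K"
        then show "y \<in> Z"
        proof (induction rule: cluster_induct)
          case (step y z)
          then show ?case using none cluster_step[OF step.hyps(1)] by blast
        qed (rule Z(2))
      qed
      then show False using \<open>\<not> ?K \<subseteq> Z\<close> by blast
    qed
    then obtain z y T where zy: "z \<in> Z" "y \<in> ?K" "y \<notin> Z"
      and T: "connected_set V E T" "card T \<le> k + 1" "z \<in> T" "y \<in> T"
      unfolding near_def by blast
    have finT: "finite T" using T(1) fin finite_subset by (auto simp: connected_set_iff_joined)
    have con: "connected_set V E (S \<union> T)"
      using connected_set_Un[OF S(2) T(1) _ T(3)] zy(1) S(1) by blast
    have "S \<union> T = S \<union> (T - {z})" using zy(1) S(1) by blast
    then have "card (S \<union> T) \<le> card S + card (T - {z})" by (metis card_Un_le)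
    also have "card (T - {z}) \<le> k" using T(2,3) finT by simp
    finally have "card (S \<union> T) \<le> Suc n * k + 1" using S(3) by simp
    moreover have "card (insert y Z) = Suc (Suc n)"
      using Z(3) zy(3) finite_subset[OF Z(1) finK] by simp
    ultimately show ?case
      using con Z(1,2) S(1) zy(2) T(4)
      by (intro exI[of _ "insert y Z"] exI[of _ "S \<union> T"] conjI) auto
  qed
  have "card ?K \<noteq> 0" using finK cluster_self[of x V E k X] by auto
  then obtain n where n: "card ?K = Suc n" by (cases "card ?K") auto
  then obtain Z S where ZS: "Z \<subseteq> ?K" "card Z = Suc n" "Z \<subseteq> S" "connected_set V E S" "card S \<le> n * k + 1"
    using grow[of n] by auto
  then have "Z = ?K" using n finK by (intro card_subset_eq) auto
  have "card ?K \<le> w + 1" using card_mono[OF finite_subset[OF X(1) fin] KX] X(2) by simp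
  then have "n * k \<le> w * k" using n by simp
  then have "card S \<le> w * k + 1" using ZS(5) by linarith
  then show ?thesis using ZS(3,4) \<open>Z = ?K\<close> by blast
qed

section \<open>The haven of a bramble without small connected cover\<close>

locale bramble_without_small_connected_cover =
  fixes V :: "'a set" and E :: "'a set set" and B :: "'a set set" and l k w :: nat
  assumes graph: "simple_graph V E" and nonempty: "V \<noteq> {}"
    and bramble: "bramble V E B"
    and gen: "edge_space.span {cycle_vector xs | xs. is_cycle V E xs \<and> length xs \<le> l}
                = cycle_space V E"
    and k: "l div 2 \<le> k" "1 \<le> k"
    and no_cover: "\<And>C. connected_set V E C \<Longrightarrow> card C \<le> w * k + 1 \<Longrightarrow> \<exists>b\<in>B. b \<inter> C = {}"
begin

text \<open>If some element of \<open>B\<close> avoids \<open>Y\<close>, this is the component of \<open>G - Y\<close> that contains all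
  elements avoiding \<open>Y\<close>; otherwise it is empty.\<close>

definition side :: "'a set \<Rightarrow> 'a set" where
  "side Y = {v. \<exists>b\<in>B. b \<inter> Y = {} \<and> (\<exists>u\<in>b. joined E (V - Y) u v)}"

text \<open>The empty set is counted as a cluster so that the intersection of the sides lies within one
  component of the graph even when \<open>X\<close> is empty.\<close>

definition clusters :: "'a set \<Rightarrow> 'a set set" where
  "clusters X = insert {} (cluster V E k X ` X)"

definition haven :: "'a set \<Rightarrow> 'a set" where
  "haven X = (\<Inter>Y\<in>clusters X. side Y)"

lemma fin: "finite V"
  using graph by (simp add: simple_graph_def)

lemma edge_in: "{x, y} \<in> E \<Longrightarrow> x \<in> V \<and> y \<in> V"
  using graph by (auto simp: simple_graph_def)

lemma bramble_connected: "b \<in> B \<Longrightarrow> connected_set V E b"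
  using bramble by (simp add: bramble_def)

lemma bramble_Un: "b \<in> B \<Longrightarrow> b' \<in> B \<Longrightarrow> u \<in> b \<Longrightarrow> v \<in> b' \<Longrightarrow> joined E (b \<union> b') u v"
  using bramble by (simp add: bramble_def connected_set_iff_joined)

lemma bramble_sub: "b \<in> B \<Longrightarrow> b \<subseteq> V" "b \<in> B \<Longrightarrow> b \<noteq> {}"
  using bramble_connected by (auto simp: connected_set_iff_joined)

lemma side_subset: "side Y \<subseteq> V - Y"
  by (auto simp: side_def dest: joined_in(2))

lemma side_joined:
  assumes "u \<in> side Y" "v \<in> side Y"
  shows "joined E (V - Y) u v"
proof -
  obtain b u0 where b: "b \<in> B" "b \<inter> Y = {}" "u0 \<in> b" "joined E (V - Y) u0 u"
    using assms(1) by (auto simp: side_def)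
  obtain b' v0 where b': "b' \<in> B" "b' \<inter> Y = {}" "v0 \<in> b'" "joined E (V - Y) v0 v"
    using assms(2) by (auto simp: side_def)
  have "b \<union> b' \<subseteq> V - Y" using b b' bramble_sub(1) by blast
  then have "joined E (V - Y) u0 v0"
    by (rule joined_mono[OF bramble_Un[OF b(1) b'(1) b(3) b'(3)] _ order_refl])
  then show ?thesis
    by (rule joined_trans[OF joined_sym[OF b(4)] joined_trans[OF _ b'(4)]])
qed

lemma side_closed:
  assumes "v \<in> side Y" "joined E (V - Y) v x"
  shows "x \<in> side Y"
proof -
  obtain b u where "b \<in> B" "b \<inter> Y = {}" "u \<in> b" "joined E (V - Y) u v"
    using assms(1) by (auto simp: side_def)
  then show ?thesis using joined_trans[OF _ assms(2)] unfolding side_def by blast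
qed

lemma side_edge:
  assumes "v \<in> side Y" "{v, x} \<in> E" "x \<notin> Y"
  shows "x \<in> side Y"
proof (rule side_closed[OF assms(1)])
  show "joined E (V - Y) v x"
    using assms edge_in[OF assms(2)] side_subset by (intro joined_edge) auto
qed

lemma side_bramble:
  assumes "b \<in> B" "b \<inter> Y = {}"
  shows "b \<subseteq> side Y"
proof
  fix u assume u: "u \<in> b"
  then have "joined E (V - Y) u u" using assms bramble_sub(1) by (intro joined_refl) blast
  then show "u \<in> side Y" using assms u unfolding side_def by blast
qed

lemma side_mono:
  assumes "Y \<subseteq> Z"
  shows "side Z \<subseteq> side Y"
proof
  fix v assume "v \<in> side Z"
  then obtain b u where b: "b \<in> B" "b \<inter> Z = {}" "u \<in> b" and j: "joined E (V - Z) u v"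
    by (auto simp: side_def)
  have "V - Z \<subseteq> V - Y" using assms by blast
  then have "joined E (V - Y) u v" by (rule joined_mono[OF j _ order_refl])
  moreover have "b \<inter> Y = {}" using b assms by blast
  ultimately show "v \<in> side Y" using b unfolding side_def by blast
qed

text \<open>The element \<open>b\<close> lies in \<open>side Y\<close>, so it avoids \<open>Z\<close> as well and lies in \<open>side Z\<close>. From there
  the connected set \<open>side Y\<close> cannot leave \<open>side Z\<close> without meeting \<open>Z\<close>.\<close>

lemma side_absorb:
  assumes b: "b \<in> B" "b \<inter> Y = {}" and disj: "side Y \<inter> Z = {}"
  shows "side Y \<subseteq> side Z"
proof
  fix v assume v: "v \<in> side Y"
  have bY: "b \<subseteq> side Y" using b by (rule side_bramble)
  then have bZ: "b \<subseteq> side Z" using b disj by (intro side_bramble) blast+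
  obtain u where u: "u \<in> b" using bramble_sub(2)[OF b(1)] by blast
  then have uY: "u \<in> side Y" using bY by blast
  from side_joined[OF uY v] show "v \<in> side Z"
  proof (induction rule: joined_induct)
    case refl
    then show ?case using u bZ by blast
  next
    case (step x y)
    have "joined E (V - Y) u y"
      by (rule joined_trans[OF step.hyps(1) joined_edge[OF step.hyps(2-4)]])
    then have "y \<notin> Z" using side_closed[OF uY] disj by blast
    then show ?case using side_edge[OF step.IH step.hyps(2)] by blast
  qed
qed

lemma empty_missed: "\<exists>b\<in>B. b \<inter> {} = {}"
proof -
  obtain v where "v \<in> V" using nonempty by blast
  then have "connected_set V E {v}" by (simp add: connected_set_iff_joined joined_refl)
  then show ?thesis using no_cover[of "{v}"] by auto
qed

lemma clusters_missed:
  assumes "X \<subseteq> V" "card X \<le> w + 1" "Y \<in> clusters X"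
  shows "\<exists>b\<in>B. b \<inter> Y = {}"
proof (cases "Y = {}")
  case False
  then obtain x where x: "x \<in> X" "Y = cluster V E k X x" using assms(3) by (auto simp: clusters_def)
  then obtain S where "Y \<subseteq> S" "connected_set V E S" "card S \<le> w * k + 1"
    using cluster_connected_hull[OF fin assms(1,2)] by metis
  then show ?thesis using no_cover[of S] by blast
qed (use empty_missed in simp)

lemma Union_clusters: "\<Union>(clusters X) = X"
proof
  have "Y \<subseteq> X" if "Y \<in> clusters X" for Y
    using that unfolding clusters_def by (elim insertE imageE) (simp_all add: cluster_subset)
  then show "\<Union>(clusters X) \<subseteq> X" by (rule Union_least)
  show "X \<subseteq> \<Union>(clusters X)"
  proof
    fix x assume "x \<in> X"
    then have "cluster V E k X x \<in> clusters X" by (simp add: clusters_def)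
    then show "x \<in> \<Union>(clusters X)" by (rule UnionI) (rule cluster_self)
  qed
qed

lemma clusters_far:
  assumes "Y \<in> clusters X" "Z \<in> clusters X" "y \<in> Y" "z \<in> Z" "near V E k y z"
  shows "Y = Z"
proof -
  obtain a b where a: "a \<in> X" "Y = cluster V E k X a" and b: "b \<in> X" "Z = cluster V E k X b"
    using assms by (auto simp: clusters_def)
  have "y \<in> X" "z \<in> X"
    using cluster_subset[OF a(1)] cluster_subset[OF b(1)] a(2) b(2) assms(3,4) by blast+
  then have "z \<in> Y" using cluster_step[OF assms(3)[unfolded a(2)] _ _ assms(5)] a(2) by simp
  then show ?thesis
    using cluster_eq[OF assms(4)[unfolded b(2)]] cluster_eq[of z V E k X a] a(2) b(2) by simp
qed

text \<open>The connected sets that link consecutive vertices of a chain in \<open>Y\<close> avoid every other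
  cluster, since all of their vertices are near to \<open>Y\<close>.\<close>

lemma cluster_one_sided:
  assumes X: "X \<subseteq> V" and Y: "Y \<in> clusters X" and Z: "Z \<in> clusters X" and ne: "Y \<noteq> Z"
    and meets: "Y \<inter> side Z \<noteq> {}"
  shows "Y \<subseteq> side Z"
proof
  fix y assume y: "y \<in> Y"
  obtain x where x: "x \<in> Y" "x \<in> side Z" using meets by blast
  obtain a where a: "a \<in> X" "Y = cluster V E k X a" using Y x by (auto simp: clusters_def)
  have Yx: "Y = cluster V E k X x" using cluster_eq[OF x(1)[unfolded a(2)]] a(2) by simp
  from y[unfolded Yx] show "y \<in> side Z"
  proof (induction rule: cluster_induct)
    case refl
    show ?case by (rule x(2))
  next
    case (step y z)
    obtain S where S: "connected_set V E S" "card S \<le> k + 1" "y \<in> S" "z \<in> S"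
      using step.hyps(4) by (auto simp: near_def)
    have "S \<inter> Z = {}"
    proof (rule ccontr)
      assume "S \<inter> Z \<noteq> {}"
      then obtain s where "s \<in> S" "s \<in> Z" by blast
      then have "near V E k y s" using S unfolding near_def by blast
      then show False using clusters_far[OF Y Z _ \<open>s \<in> Z\<close>] step.hyps(1) Yx ne by blast
    qed
    then have "S \<subseteq> V - Z" using S(1) by (auto simp: connected_set_iff_joined)
    moreover have "joined E S y z" using S by (simp add: connected_set_iff_joined)
    ultimately have "joined E (V - Z) y z" using joined_mono[of E S y z "V - Z" E] by blast
    then show ?case by (rule side_closed[OF step.IH])
  qed
qed

text \<open>Choose a cluster \<open>M\<close> whose side is minimal. For any other cluster \<open>Y\<close>, either \<open>side M\<close> avoids
  \<open>Y\<close> and then is contained in \<open>side Y\<close>, or \<open>Y\<close> lies in \<open>side M\<close> and, by minimality, \<open>M\<close> lies in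
  \<open>side Y\<close>. A vertex \<open>d\<close> of \<open>side M\<close> with a neighbour in \<open>M\<close> belongs to all sides: in the second case
  its neighbour lies in \<open>side Y\<close>, while \<open>d\<close> itself is too close to \<open>M\<close> to lie in \<open>Y\<close>. If there is no
  such \<open>d\<close>, then \<open>side M\<close> is a component of the graph. It contains the whole bramble and therefore
  every other side, and by minimality all sides coincide.\<close>

lemma haven_nonempty:
  assumes X: "X \<subseteq> V" "card X \<le> w + 1"
  shows "haven X \<noteq> {}"
proof -
  have "finite (side ` clusters X)"
    using finite_subset[OF X(1) fin] by (simp add: clusters_def)
  moreover have "side ` clusters X \<noteq> {}" by (simp add: clusters_def)
  ultimately obtain m where "m \<in> side ` clusters X" and mm: "\<forall>s\<in>side ` clusters X. s \<subseteq> m \<longrightarrow> m = s"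
    using finite_has_minimal by metis
  then obtain M where M: "M \<in> clusters X" "m = side M" by blast
  have min: "side Y = side M" if "Y \<in> clusters X" "side Y \<subseteq> side M" for Y
    using mm that M by auto
  obtain bM where bM: "bM \<in> B" "bM \<inter> M = {}" using clusters_missed[OF X M(1)] by blast
  show ?thesis
  proof (cases "\<exists>d x. d \<in> side M \<and> x \<notin> side M \<and> {d, x} \<in> E")
    case True
    then obtain d x where d: "d \<in> side M" and x: "x \<notin> side M" and dx: "{d, x} \<in> E" by blast
    have xM: "x \<in> M" using side_edge[OF d dx] x by blast
    have "d \<in> side Y" if Y: "Y \<in> clusters X" for Y
    proof (cases "Y = M \<or> side M \<inter> Y = {}")
      case True
      then show ?thesis using d side_absorb[OF bM] by blast
    next
      case False
      then have YM: "Y \<subseteq> side M" using cluster_one_sided[OF X(1) Y M(1)] by blast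
      obtain bY where bY: "bY \<in> B" "bY \<inter> Y = {}" using clusters_missed[OF X Y] by blast
      have "side Y \<inter> M \<noteq> {}"
      proof
        assume "side Y \<inter> M = {}"
        then have "side Y = side M" using min[OF Y] side_absorb[OF bY] by blast
        then show False using YM False side_subset[of Y] by blast
      qed
      then have "M \<subseteq> side Y" using cluster_one_sided[OF X(1) M(1) Y] False by blast
      moreover have "d \<notin> Y"
      proof
        assume "d \<in> Y"
        moreover have "near V E k d x" using near_edge[OF dx] edge_in[OF dx] k(2) by blast
        ultimately show False using clusters_far[OF Y M(1) _ xM] False by blast
      qed
      ultimately show ?thesis using side_edge[of x Y d] xM dx by (auto simp: insert_commute)
    qed
    then show ?thesis unfolding haven_def by blast
  next
    case False
    have closed: "v \<in> side M" if "joined E S u v" "u \<in> side M" for S u v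
      using that(1)
    proof (induction rule: joined_induct)
      case refl
      show ?case by (rule that(2))
    next
      case (step x y)
      then show ?case using False by blast
    qed
    have bMM: "bM \<subseteq> side M" using bM by (rule side_bramble)
    obtain u where u: "u \<in> bM" using bramble_sub(2)[OF bM(1)] by blast
    have "side Y \<subseteq> side M" if Y: "Y \<in> clusters X" for Y
    proof
      fix v assume v: "v \<in> side Y"
      obtain bY where bY: "bY \<in> B" "bY \<inter> Y = {}" using clusters_missed[OF X Y] by blast
      obtain y where y: "y \<in> bY" using bramble_sub(2)[OF bY(1)] by blast
      have "y \<in> side M" using closed[OF bramble_Un[OF bM(1) bY(1) u y]] bMM u by blast
      moreover have "y \<in> side Y" using side_bramble[OF bY] y by blast
      ultimately show "v \<in> side M" using closed[OF side_joined[OF _ v]] by blast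
    qed
    then have "u \<in> haven X" using min bMM u unfolding haven_def by blast
    then show ?thesis by blast
  qed
qed

text \<open>The clusters are removed one at a time; no cycle of length at most \<open>l\<close> meets a new cluster and
  an earlier one.\<close>

lemma haven_joined:
  assumes X: "X \<subseteq> V" and u: "u \<in> haven X" and v: "v \<in> haven X"
  shows "joined E (V - X) u v"
proof -
  have uv: "joined E (V - Y) u v" if "Y \<in> clusters X" for Y
    using side_joined u v that unfolding haven_def by blast
  have "joined E (V - \<Union>\<Z>) u v" if "finite \<Z>" "\<Z> \<subseteq> clusters X" for \<Z>
    using that
  proof (induction rule: finite_induct)
    case empty
    have "{} \<in> clusters X" by (simp add: clusters_def)
    then show ?case using uv[of "{}"] by simp
  next
    case (insert Z \<Z>)
    have "joined E (V - (Z \<union> \<Union>\<Z>)) u v"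
    proof (rule joined_avoiding_Un_if_far[OF graph gen])
      fix xs assume c: "is_cycle V E xs" "length xs \<le> l"
      show "set xs \<inter> Z = {} \<or> set xs \<inter> \<Union>\<Z> = {}"
      proof (rule ccontr)
        assume "\<not> ?thesis"
        then obtain x y Y where xy: "x \<in> set xs" "x \<in> Z" "y \<in> set xs" "y \<in> Y" "Y \<in> \<Z>" by blast
        have "length xs div 2 \<le> k" using c(2) k(1) by linarith
        then have "near V E k x y" using near_on_cycle[OF c(1) xy(1,3)] by blast
        then have "Z = Y" using clusters_far[of Z X Y x y] insert.prems xy by blast
        then show False using insert.hyps(2) xy by blast
      qed
    qed (use uv insert in auto)
    then show ?case by simp
  qed
  moreover have "finite (clusters X)" using finite_subset[OF X fin] by (simp add: clusters_def)
  ultimately show ?thesis using Union_clusters[of X] by (metis order_refl)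
qed

text \<open>Every cluster of \<open>A\<close> is contained in a cluster of \<open>X\<close>, and a larger cluster has a smaller side.\<close>

lemma haven_mono:
  assumes "A \<subseteq> X"
  shows "haven X \<subseteq> haven A"
proof -
  have finer: "\<exists>Z\<in>clusters X. Y \<subseteq> Z" if Y: "Y \<in> clusters A" for Y
  proof (cases "Y = {}")
    case False
    then obtain a where a: "a \<in> A" "Y = cluster V E k A a" using Y by (auto simp: clusters_def)
    then have "cluster V E k X a \<in> clusters X" using assms by (auto simp: clusters_def)
    then show ?thesis using cluster_mono[OF assms] a(2) by blast
  next
    case True
    then show ?thesis unfolding clusters_def by blast
  qed
  show ?thesis
    unfolding haven_def
  proof (rule INT_greatest)
    fix Y assume "Y \<in> clusters A"
    then obtain Z where "Z \<in> clusters X" "Y \<subseteq> Z" using finer by blast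
    then show "(\<Inter>Z\<in>clusters X. side Z) \<subseteq> side Y" using side_mono[of Y Z] by blast
  qed
qed

lemma no_tree_decomposition:
  assumes "tree_decomposition V E N F P" "\<And>t. t \<in> N \<Longrightarrow> card (P t) \<le> w + 1"
  shows False
  using assms fin haven_nonempty haven_joined haven_mono
  by (rule haven_contradicts_tree_decomposition[where D = haven])

end

section \<open>Tree-width and the generating length\<close>

lemma cycle_edges_nonempty:
  assumes "is_cycle V E xs"
  shows "cycle_edges xs \<noteq> {}"
proof -
  have "0 < length xs" using assms by (auto simp: is_cycle_def)
  then show ?thesis by (auto simp: cycle_edges_def)
qed

text \<open>The decomposition into a single part shows that the minimum is attained.\<close>

lemma tree_decomposition_of_treewidth:
  assumes "simple_graph V E"
  obtains N :: "nat set" and F P where "tree_decomposition V E N F P" "width N P = treewidth V E"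
proof -
  have "\<not> is_cycle {0::nat} {} xs" for xs
    using cycle_edges_nonempty[of "{0::nat}" "{}" xs] by (auto simp: is_cycle_def)
  then have "is_tree {0::nat} {}"
    by (auto simp: is_tree_def simple_graph_def connected_graph_def)
  moreover have "connected_set {0::nat} {} {0}"
    by (auto simp: connected_set_iff_joined joined_refl)
  ultimately have "tree_decomposition V E {0::nat} {} (\<lambda>_. V)"
    using assms by (auto simp: tree_decomposition_def simple_graph_def)
  then have "\<exists>w. \<exists>(N :: nat set) F P. tree_decomposition V E N F P \<and> width N P = w" by blast
  then have "\<exists>(N :: nat set) F P. tree_decomposition V E N F P \<and> width N P = treewidth V E"
    unfolding treewidth_def by (rule LeastI_ex)
  then show thesis using that by blast
qed

text \<open>All cycles have length at most \<open>card V\<close>, so some length qualifies and the least one does.\<close>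

lemma short_cycles_generate:
  assumes "simple_graph V E"
  shows "edge_space.span {cycle_vector xs | xs. is_cycle V E xs \<and> length xs \<le> cycle_gen_length V E}
           = cycle_space V E"
proof -
  have "length xs \<le> card V" if "is_cycle V E xs" for xs
    using that assms card_mono[of V "set xs"] distinct_card[of xs]
    by (auto simp: is_cycle_def simple_graph_def)
  then have "{cycle_vector xs | xs. is_cycle V E xs \<and> length xs \<le> card V}
      = {cycle_vector xs | xs. is_cycle V E xs}" by auto
  then have "edge_space.span {cycle_vector xs | xs. is_cycle V E xs \<and> length xs \<le> card V}
      = cycle_space V E" by (simp add: cycle_space_def)
  then show ?thesis unfolding cycle_gen_length_def by (rule LeastI)
qed

text \<open>No cycle has length below three, and the empty set does not generate the vector of a cycle,
  which is not zero.\<close>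

lemma cycle_gen_length_ge:
  assumes G: "simple_graph V E" and c: "is_cycle V E xs"
  shows "3 \<le> cycle_gen_length V E"
proof (rule ccontr)
  assume "\<not> ?thesis"
  then have no_short: "{cycle_vector xs | xs. is_cycle V E xs \<and> length xs \<le> cycle_gen_length V E} = {}"
    by (auto simp: is_cycle_def)
  have "cycle_space V E = {0}" using short_cycles_generate[OF G] unfolding no_short by simp
  moreover have "cycle_vector xs \<in> cycle_space V E"
    unfolding cycle_space_def using c by (intro edge_space.span_base) auto
  ultimately have z: "cycle_vector xs = 0" by simp
  obtain e where "e \<in> cycle_edges xs" using cycle_edges_nonempty[OF c] by blast
  then show False using fun_cong[OF z, of e] by (simp add: cycle_vector_def)
qed

theorem theorem4:
  fixes V :: "'a set" and E :: "'a set set" and B :: "'a set set"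
  assumes "simple_graph V E"
    and "\<exists>xs. is_cycle V E xs"
    and "bramble V E B"
  shows "connected_order V E B \<le> treewidth V E * (cycle_gen_length V E div 2) + 1"
proof (rule ccontr)
  let ?w = "treewidth V E" and ?k = "cycle_gen_length V E div 2"
  assume big: "\<not> ?thesis"
  obtain xs where xs: "is_cycle V E xs" using assms(2) by blast
  interpret bramble_without_small_connected_cover V E B "cycle_gen_length V E" ?k ?w
  proof
    show "V \<noteq> {}" using xs by (auto simp: is_cycle_def)
    show "1 \<le> ?k" using cycle_gen_length_ge[OF assms(1) xs] by linarith
    fix C assume C: "connected_set V E C" "card C \<le> ?w * ?k + 1"
    show "\<exists>b\<in>B. b \<inter> C = {}"
    proof (rule ccontr)
      assume "\<not> ?thesis"
      then have "bramble_cover V B C" using C(1) by (auto simp: bramble_cover_def connected_set_def)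
      then have "connected_order V E B \<le> card C"
        unfolding connected_order_def using C(1) by (intro Least_le) blast
      then show False using C(2) big by linarith
    qed
  qed (use assms short_cycles_generate in auto)
  obtain N :: "nat set" and F P where td: "tree_decomposition V E N F P" and wd: "width N P = ?w"
    using tree_decomposition_of_treewidth[OF assms(1)] by blast
  have "finite N" using td by (auto simp: tree_decomposition_def is_tree_def simple_graph_def)
  have "card (P t) \<le> ?w + 1" if "t \<in> N" for t
  proof -
    have "card (P t) \<le> Max ((\<lambda>t. card (P t)) ` N)" using \<open>finite N\<close> that by simp
    then show ?thesis using wd unfolding width_def by linarith
  qed
  then show False by (rule no_tree_decomposition[OF td])
qed

end
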